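(* Let $n\geq2$, let $A\in\mathbb{R}^{n\times n}$ satisfy $A=A^\top$, and let $T>0$. Choose any orthonormal eigenbasis $(e_1,\ldots,e_n)$ with $Ae_j=a_je_j$, and set $g_j(T)=\int_0^Te^{2a_jt}\,dt$. Then $$\gamma_{\mathrm{rel}}(A,T)=\bigg(\sum_{j=1}^n\frac1{g_j(T)}\bigg)^{-1}.$$ In this eigenbasis, the unique relaxed maximizer is $$X_\star=\operatorname{diag}\left(\frac{\gamma_{\mathrm{rel}}(A,T)}{g_1(T)},\ldots,\frac{\gamma_{\mathrm{rel}}(A,T)}{g_n(T)}\right).$$ Consequently, $r(A,T)=n$ and $\gamma_k(A,T)<\gamma_{\mathrm{rel}}(A,T)$ for every $k<n$ and every $T>0$.
   Context: For $A\in\mathbb{R}^{n\times n}$, $T>0$ and a real symmetric $n\times n$ matrix $X$, set $\mathcal{G}_T(X)=\int_0^Te^{tA}Xe^{tA^\top}\,dt$. For $k\in\{1,\ldots,n\}$, $\gamma_k(A,T)=\max\{\lambda_{\min}(\mathcal{G}_T(X))\mid X\succeq0,\ \operatorname{tr}X=1,\ \operatorname{rank}X\leq k\}$, and $\gamma_{\mathrm{rel}}(A,T)=\max\{\lambda_{\min}(\mathcal{G}_T(X))\mid X\succeq0,\ \operatorname{tr}X=1\}$. A relaxed maximizer is an $X\succeq0$ with $\operatorname{tr}X=1$ attaining the latter maximum; $r(A,T)$ is the least rank of a relaxed maximizer. *)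

theory Defs
  imports "HOL-Analysis.Analysis"
begin

(* The library multiplication on real^'n^'n is componentwise, so neither the
   class operation ^ nor exp gives matrix powers or the matrix exponential. *)

definition matpow :: "real^'n^'n \<Rightarrow> nat \<Rightarrow> real^'n^'n" where
  "matpow A k = (((**) A) ^^ k) (mat 1)"

definition mexp :: "real^'n^'n \<Rightarrow> real^'n^'n" where
  "mexp A = (\<Sum>k. (1 / fact k) *\<^sub>R matpow A k)"

definition gramian :: "real^'n^'n \<Rightarrow> real \<Rightarrow> real^'n^'n \<Rightarrow> real^'n^'n" where
  "gramian A T X =
     integral {0..T} (\<lambda>t. mexp (t *\<^sub>R A) ** X ** mexp (t *\<^sub>R transpose A))"

definition eigenvalue :: "real^'n^'n \<Rightarrow> real \<Rightarrow> bool" where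
  "eigenvalue M l \<longleftrightarrow> (\<exists>v. v \<noteq> 0 \<and> M *v v = l *\<^sub>R v)"

(* Only meaningful for symmetric M, where the real eigenvalues form a
   nonempty finite set. *)
definition lambda_min :: "real^'n^'n \<Rightarrow> real" where
  "lambda_min M = (LEAST l. eigenvalue M l)"

definition psd :: "real^'n^'n \<Rightarrow> bool" where
  "psd X \<longleftrightarrow> transpose X = X \<and> (\<forall>v. 0 \<le> v \<bullet> (X *v v))"

(* The maxima range over infinite sets, so they are written with GREATEST
   rather than Max; GREATEST only has a specified value if the maximum is attained. *)

definition gamma_k :: "nat \<Rightarrow> real^'n^'n \<Rightarrow> real \<Rightarrow> real" where
  "gamma_k k A T =
     (GREATEST l. \<exists>X. psd X \<and> trace X = 1 \<and> rank X \<le> k \<and> l = lambda_min (gramian A T X))"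

definition gamma_rel :: "real^'n^'n \<Rightarrow> real \<Rightarrow> real" where
  "gamma_rel A T =
     (GREATEST l. \<exists>X. psd X \<and> trace X = 1 \<and> l = lambda_min (gramian A T X))"

definition relaxed_maximizer :: "real^'n^'n \<Rightarrow> real \<Rightarrow> real^'n^'n \<Rightarrow> bool" where
  "relaxed_maximizer A T X \<longleftrightarrow>
     is_arg_max (\<lambda>X. lambda_min (gramian A T X)) (\<lambda>X. psd X \<and> trace X = 1) X"

definition least_rank :: "real^'n^'n \<Rightarrow> real \<Rightarrow> nat" where
  "least_rank A T = (LEAST m. \<exists>X. relaxed_maximizer A T X \<and> rank X = m)"

(* The vectors are indexed by the type 'n, in place of {1..n}. Any CARD('n)
   orthonormal vectors form a basis, so spanning need not be required. *)
definition orthonormal_eigenbasis ::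
    "real^'n^'n \<Rightarrow> ('n \<Rightarrow> real^'n) \<Rightarrow> ('n \<Rightarrow> real) \<Rightarrow> bool" where
  "orthonormal_eigenbasis A e a \<longleftrightarrow>
     (\<forall>i j. e i \<bullet> e j = (if i = j then 1 else 0)) \<and> (\<forall>j. A *v e j = a j *\<^sub>R e j)"

definition gfun :: "real \<Rightarrow> real \<Rightarrow> real" where
  "gfun a T = integral {0..T} (\<lambda>t. exp (2 * a * t))"

definition diag :: "('n \<Rightarrow> real) \<Rightarrow> real^'n^'n" where
  "diag d = (\<chi> i j. if i = j then d i else 0)"

(* The matrix, in standard coordinates, of the operator that has matrix D in
   the orthonormal basis e: Q D Q^T, where the columns of Q are the e j. *)
definition in_basis :: "('n \<Rightarrow> real^'n) \<Rightarrow> real^'n^'n \<Rightarrow> real^'n^'n" where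
  "in_basis e D = (let Q = (\<chi> i j. e j $ i) in Q ** D ** transpose Q)"

end

(* In the eigenbasis the entries of the Gramian are G_ij = k_ij x_ij, where
   k_ij is the integral of exp ((a_i + a_j) t) and k_jj = g_j. Since the least
   eigenvalue m of G is at most each G_jj = g_j x_jj, dividing by g_j and
   summing gives m * (sum of 1 / g_j) <= tr X = 1. In case of equality
   x_jj = m / g_j, so the positive semidefinite matrix G - m I has zero diagonal
   and hence vanishes; as all k_ij > 0, X is then diagonal. This maximizer has
   full rank, and gamma_k is attained because the rank is lower semicontinuous
   and the set of density matrices is compact. *)

theory Submission
  imports Defs
begin

subsection \<open>Symmetric matrices and rank\<close>

lemma mat_vector_mult: "mat l *v u = l *\<^sub>R u" for u :: "real^'n"
  by (simp add: matrix_vector_mult_def mat_def vec_eq_iff if_distrib[of "\<lambda>x. x * _"] cong: if_cong)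

lemma symmetric_dot:
  fixes M :: "real^'n^'n"
  assumes "transpose M = M"
  shows "(M *v x) \<bullet> y = x \<bullet> (M *v y)"
  by (metis assms dot_lmul_matrix transpose_matrix_vector)

text \<open>The form cannot decrease in the direction \<open>- (N *v v)\<close>, along which its derivative
  at \<open>v\<close> is \<open>-2 * norm (N *v v) ^ 2\<close>.\<close>

lemma quadratic_form_null:
  fixes N :: "real^'n^'n"
  assumes sym: "transpose N = N" and S: "subspace S"
    and nonneg: "\<And>u. u \<in> S \<Longrightarrow> 0 \<le> u \<bullet> (N *v u)"
    and v: "v \<in> S" "N *v v \<in> S" "v \<bullet> (N *v v) = 0"
  shows "N *v v = 0"
proof (rule ccontr)
  define w where "w = N *v v"
  define b where "b = w \<bullet> w"
  define c where "c = w \<bullet> (N *v w)"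
  assume "N *v v \<noteq> 0"
  then have b: "b > 0" by (simp add: b_def w_def)
  have c: "c \<ge> 0" using nonneg v by (simp add: c_def w_def)
  \<comment> \<open>With this step \<open>s * c < b\<close>, so the quadratic term cannot offset the
    decrease \<open>2 * s * b\<close>; the \<open>+ 1\<close> covers \<open>c = 0\<close>.\<close>
  define s where "s = b / (c + 1)"
  have s: "s > 0" using b c by (simp add: s_def)
  have "v - s *\<^sub>R w \<in> S"
    using S v by (simp add: w_def subspace_diff subspace_scale)
  then have "0 \<le> (v - s *\<^sub>R w) \<bullet> (N *v (v - s *\<^sub>R w))" by (rule nonneg)
  also have "\<dots> = - 2 * s * b + s\<^sup>2 * c"
    using v symmetric_dot[OF sym, of v w]
    by (simp add: algebra_simps b_def c_def w_def[symmetric] power2_eq_square)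
  finally have "s * (2 * b) \<le> s * (s * c)"
    by (simp add: power2_eq_square algebra_simps)
  then have "2 * b \<le> s * c"
    using s by simp
  also have "\<dots> < b"
    using b c by (simp add: s_def field_simps)
  finally show False using b by simp
qed

section \<open>Rayleigh minimization and orthonormal eigenbases\<close>

text \<open>Compactness of the unit sphere of \<open>S\<close> yields a minimizer \<open>v\<close>
  of the quadratic form. Subtracting its value from \<open>M\<close> leaves a form that is
  nonnegative on \<open>S\<close> and null at \<open>v\<close>, so \<open>v\<close> is an
  eigenvector. Allowing any invariant \<open>S\<close> serves both \<open>lambda_min\<close> and the
  induction over orthogonal complements.\<close>

lemma symmetric_rayleigh_min:
  fixes M :: "real^'n^'n"
  assumes sym: "transpose M = M" and S: "subspace S"
    and inv: "\<And>u. u \<in> S \<Longrightarrow> M *v u \<in> S" and nz: "x \<in> S" "x \<noteq> 0"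
  obtains v l where "v \<in> S" "norm v = 1" "M *v v = l *\<^sub>R v"
    "\<And>u. u \<in> S \<Longrightarrow> l * (u \<bullet> u) \<le> u \<bullet> (M *v u)"
proof -
  let ?K = "sphere 0 1 \<inter> S"
  have "compact ?K"
    using S by (simp add: closed_subspace compact_Int_closed)
  moreover have "x /\<^sub>R norm x \<in> ?K"
    using nz S by (simp add: subspace_scale)
  moreover have "continuous_on ?K (\<lambda>u. u \<bullet> (M *v u))"
    by (intro continuous_intros)
  ultimately obtain v where v: "v \<in> ?K" and
    min: "\<And>u. u \<in> ?K \<Longrightarrow> v \<bullet> (M *v v) \<le> u \<bullet> (M *v u)"
    using continuous_attains_inf[of ?K "\<lambda>u. u \<bullet> (M *v u)"] by blast
  define l where "l = v \<bullet> (M *v v)"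
  have le: "l * (u \<bullet> u) \<le> u \<bullet> (M *v u)" if u: "u \<in> S" for u
  proof (cases "u = 0")
    case False
    then have "u /\<^sub>R norm u \<in> ?K" using u S by (simp add: subspace_scale)
    from min[OF this] show ?thesis
      using False
      by (simp add: l_def matrix_vector_mult_scaleR field_simps dot_square_norm power2_eq_square)
  qed simp
  define N where "N = M - mat l"
  have N: "N *v u = M *v u - l *\<^sub>R u" for u
    by (simp add: N_def matrix_vector_mult_diff_rdistrib mat_vector_mult)
  have tr: "transpose N = N"
    using sym by (simp add: N_def transpose_def vec_eq_iff mat_def)
  have vv: "v \<bullet> v = 1" using v by (simp add: dot_square_norm)
  have "N *v v = 0"
  proof (rule quadratic_form_null[OF tr S])
    show "0 \<le> u \<bullet> (N *v u)" if "u \<in> S" for u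
      using le[OF that] by (simp add: N inner_diff_right)
    show "v \<in> S" using v by simp
    show "N *v v \<in> S" using v inv S by (simp add: N subspace_diff subspace_scale)
    show "v \<bullet> (N *v v) = 0" using vv by (simp add: N inner_diff_right l_def)
  qed
  then have "M *v v = l *\<^sub>R v" by (simp add: N)
  with v le show ?thesis by (intro that[of v l]) auto
qed

text \<open>The least Rayleigh value is an eigenvalue, and every eigenvalue is a Rayleigh value, so
  the \<open>LEAST\<close> is attained. From here on \<open>lambda_min\<close> is handled only
  through quadratic forms.\<close>

lemma symmetric_lambda_min:
  fixes M :: "real^'n^'n"
  assumes sym: "transpose M = M"
  shows lambda_min_le: "lambda_min M * (u \<bullet> u) \<le> u \<bullet> (M *v u)"
    and le_lambda_min: "(\<And>u. l * (u \<bullet> u) \<le> u \<bullet> (M *v u)) \<Longrightarrow> l \<le> lambda_min M"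
proof -
  \<comment> \<open>\<open>axis undefined 1\<close> serves only as some nonzero vector of the whole
    space.\<close>
  obtain v m where v: "norm v = 1" "M *v v = m *\<^sub>R v"
    and m: "\<And>u. m * (u \<bullet> u) \<le> u \<bullet> (M *v u)"
    using symmetric_rayleigh_min[OF sym subspace_UNIV, of "axis undefined 1"]
    by (metis UNIV_I axis_eq_0_iff zero_neq_one)
  have vv: "v \<bullet> v = 1" using v by (simp add: dot_square_norm)
  have "lambda_min M = m"
    unfolding lambda_min_def
  proof (rule Least_equality)
    show "eigenvalue M m" using v unfolding eigenvalue_def by (metis norm_zero zero_neq_one)
    show "m \<le> k" if "eigenvalue M k" for k
    proof -
      from that obtain w where w: "w \<noteq> 0" "M *v w = k *\<^sub>R w" unfolding eigenvalue_def by blast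
      then show ?thesis using m[of w] by simp
    qed
  qed
  then show "lambda_min M * (u \<bullet> u) \<le> u \<bullet> (M *v u)" using m by simp
  show "l \<le> lambda_min M" if "\<And>u. l * (u \<bullet> u) \<le> u \<bullet> (M *v u)"
    using that[of v] vv v \<open>lambda_min M = m\<close> by simp
qed

text \<open>By symmetry the orthogonal complement of the eigenvectors found so far is invariant
  under \<open>A\<close>; while there are fewer than \<open>CARD('n)\<close> of them it is nonzero
  and contains a further one.\<close>

lemma symmetric_orthonormal_eigenvectors:
  fixes A :: "real^'n^'n"
  assumes sym: "transpose A = A" and "m \<le> CARD('n)"
  shows "\<exists>B. finite B \<and> card B = m \<and> (\<forall>x\<in>B. norm x = 1 \<and> (\<exists>l. A *v x = l *\<^sub>R x)) \<and>
    pairwise orthogonal B"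
  using assms(2)
proof (induction m)
  case 0
  show ?case by (rule exI[of _ "{}"]) simp
next
  case (Suc m)
  then obtain B where B: "finite B" "card B = m" "pairwise orthogonal B"
    and eig: "\<And>x. x \<in> B \<Longrightarrow> norm x = 1 \<and> (\<exists>l. A *v x = l *\<^sub>R x)"
    using Suc_leD by blast
  let ?S = "{y. \<forall>x\<in>B. orthogonal x y}"
  have "dim B < DIM(real^'n)"
    using Suc.prems B(2) dim_le_card'[OF B(1)] by simp
  then obtain x where x: "x \<noteq> 0" "\<And>y. y \<in> span B \<Longrightarrow> orthogonal x y"
    using orthogonal_to_subspace_exists by blast
  have xS: "x \<in> ?S" using x by (simp add: orthogonal_commute span_base)
  have inv: "A *v u \<in> ?S" if "u \<in> ?S" for u
  proof (intro CollectI ballI)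
    fix y assume y: "y \<in> B"
    then obtain l where "A *v y = l *\<^sub>R y" using eig by blast
    then show "orthogonal y (A *v u)"
      using that y by (simp add: orthogonal_def flip: symmetric_dot[OF sym])
  qed
  obtain v l where v: "v \<in> ?S" "norm v = 1" "A *v v = l *\<^sub>R v"
    by (rule symmetric_rayleigh_min[OF sym subspace_orthogonal_to_vectors inv xS x(1)])
  have "v \<notin> B" using v by (auto simp: orthogonal_self)
  show ?case
  proof (rule exI[of _ "insert v B"], intro conjI ballI)
    show "finite (insert v B)" "card (insert v B) = Suc m"
      using B \<open>v \<notin> B\<close> by simp_all
    show "norm y = 1" "\<exists>l. A *v y = l *\<^sub>R y" if "y \<in> insert v B" for y
      using that v eig by auto
    show "pairwise orthogonal (insert v B)"
      using B v by (simp add: pairwise_insert orthogonal_commute)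
  qed
qed

text \<open>The claims on \<open>least_rank\<close> and \<open>gamma_k\<close> mention no basis, so
  their proof needs one to exist.\<close>

lemma symmetric_orthonormal_eigenbasis:
  fixes A :: "real^'n^'n"
  assumes "transpose A = A"
  obtains e a where "orthonormal_eigenbasis A e a"
proof -
  obtain B where B: "finite B" "card B = CARD('n)" "pairwise orthogonal B"
    and eig: "\<And>x. x \<in> B \<Longrightarrow> norm x = 1 \<and> (\<exists>l. A *v x = l *\<^sub>R x)"
    using symmetric_orthonormal_eigenvectors[OF assms order_refl] by blast
  obtain e where e: "bij_betw e (UNIV :: 'n set) B"
    using B finite_same_card_bij[of "UNIV :: 'n set" B] by auto
  then have eB: "e i \<in> B" for i by (auto simp: bij_betw_def)
  have "\<forall>j. \<exists>l. A *v e j = l *\<^sub>R e j" using eB eig by blast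
  then obtain a where "\<And>j. A *v e j = a j *\<^sub>R e j" by metis
  moreover have "e i \<bullet> e j = (if i = j then 1 else 0)" for i j
  proof (cases "i = j")
    case True
    then show ?thesis using eig[OF eB] by (simp add: dot_square_norm)
  next
    case False
    then have "e i \<noteq> e j" using e by (auto simp: bij_betw_def inj_on_def)
    then show ?thesis using B(3) eB False by (simp add: pairwise_def orthogonal_def)
  qed
  ultimately show ?thesis
    by (intro that[of e a]) (simp add: orthonormal_eigenbasis_def)
qed

section \<open>Perturbation bounds and semicontinuity of the rank\<close>

lemma matrix_vector_mult_bound:
  obtains C where "C > 0" "\<And>M x. norm ((M :: real^'n^'m) *v x) \<le> C * norm M * norm x"
proof -
  have "bilinear ((*v) :: real^'n^'m \<Rightarrow> _)"
    unfolding bilinear_def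
    by (intro conjI allI linearI)
      (simp_all add: matrix_vector_mult_add_rdistrib scaleR_matrix_vector_assoc
        matrix_vector_right_distrib matrix_vector_mult_scaleR)
  then show ?thesis using bilinear_bounded_pos that by metis
qed

text \<open>\<open>X\<close> is injective on its row space, bounded below there by \<open>r\<close>, so nearby matrices
  are injective on it as well.\<close>

lemma rank_lower_semicontinuous:
  fixes X :: "real^'n^'m"
  obtains d where "d > 0" "\<And>Y. dist Y X < d \<Longrightarrow> rank X \<le> rank Y"
proof -
  let ?U = "span (rows X)"
  have inj: "\<forall>x\<in>?U. X *v x = 0 \<longrightarrow> x = 0"
    using nullspace_inter_rowspace by blast
  obtain r where r: "r > 0" "\<And>x. x \<in> ?U \<Longrightarrow> r * norm x \<le> norm (X *v x)"
    using injective_imp_isometric[OF closed_span subspace_span matrix_vector_mul_bounded_linear inj]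
    by blast
  obtain C where C: "C > 0" "\<And>M x. norm ((M :: real^'n^'m) *v x) \<le> C * norm M * norm x"
    using matrix_vector_mult_bound by blast
  have "rank X \<le> rank Y" if "dist Y X < r / C" for Y
  proof -
    have "x = 0" if x: "x \<in> ?U" and "Y *v x = 0" for x
    proof (rule ccontr)
      assume "x \<noteq> 0"
      have "r * norm x \<le> norm ((Y - X) *v x)"
        using r(2)[OF x] \<open>Y *v x = 0\<close> by (simp add: matrix_vector_mult_diff_rdistrib)
      also have "\<dots> \<le> C * dist Y X * norm x" unfolding dist_norm by (rule C(2))
      also have "\<dots> < r * norm x"
        using \<open>dist Y X < r / C\<close> \<open>x \<noteq> 0\<close> C(1) by (simp add: field_simps)
      finally show False by simp
    qed
    then have "inj_on ((*v) Y) ?U"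
      by (metis linear_injective_on_subspace_0 matrix_vector_mul_linear subspace_span)
    \<comment> \<open>An injective image of the row space keeps its dimension,
      \<open>rank X\<close>, and lies in the range of \<open>Y\<close>.\<close>
    then have "dim ((*v) Y ` rows X) = dim (rows X)"
      by (simp add: dim_image_eq)
    then show ?thesis
      unfolding row_rank_def[of X] rank_dim_range[of Y]
      by (metis dim_subset image_mono subset_UNIV)
  qed
  with r C show ?thesis by (intro that[of "r / C"]) auto
qed

lemma closed_rank_le: "closed {X :: real^'n^'m. rank X \<le> k}"
proof -
  have "open {X :: real^'n^'m. k < rank X}"
    unfolding open_dist
  proof
    fix X :: "real^'n^'m"
    assume X: "X \<in> {X. k < rank X}"
    obtain d where "d > 0" "\<And>Y. dist Y X < d \<Longrightarrow> rank X \<le> rank Y"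
      using rank_lower_semicontinuous[of X] by blast
    with X show "\<exists>d>0. \<forall>Y. dist Y X < d \<longrightarrow> Y \<in> {X. k < rank X}"
      by (intro exI[of _ d]) fastforce
  qed
  moreover have "{X :: real^'n^'m. rank X \<le> k} = - {X. k < rank X}" by auto
  ultimately show ?thesis by (simp add: closed_def)
qed

subsection \<open>The Gramian in an eigenbasis\<close>

lemma in_basis_diag_component:
  "in_basis e (diag d) $ r $ s = (\<Sum>j\<in>UNIV. e j $ r * d j * e j $ s)"
  by (simp add: in_basis_def Let_def matrix_matrix_mult_def diag_def transpose_def
      if_distrib[of "\<lambda>x. _ * x"] cong: if_cong)

text \<open>This is the spectral form, a weighted sum of the rank-one operators of the
  \<open>e j\<close>; it holds for any family \<open>e\<close>.\<close>

lemma in_basis_diag_mult: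
  "in_basis e (diag d) *v v = (\<Sum>j\<in>UNIV. (d j * (e j \<bullet> v)) *\<^sub>R e j)"
proof -
  have "(in_basis e (diag d) *v v) $ r = (\<Sum>j\<in>UNIV. (d j * (e j \<bullet> v)) *\<^sub>R e j) $ r" for r
  proof -
    have "(in_basis e (diag d) *v v) $ r = (\<Sum>s\<in>UNIV. \<Sum>j\<in>UNIV. e j $ r * d j * e j $ s * v $ s)"
      by (simp add: matrix_vector_mult_def in_basis_diag_component sum_distrib_right)
    also have "\<dots> = (\<Sum>j\<in>UNIV. \<Sum>s\<in>UNIV. e j $ r * d j * e j $ s * v $ s)"
      by (rule sum.swap)
    also have "\<dots> = (\<Sum>j\<in>UNIV. (d j * (e j \<bullet> v)) *\<^sub>R e j) $ r"
      by (simp add: inner_vec_def sum_distrib_left mult_ac)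
    finally show ?thesis .
  qed
  then show ?thesis by (simp add: vec_eq_iff)
qed

lemma transpose_in_basis_diag: "transpose (in_basis e (diag d)) = in_basis e (diag d)"
  by (simp add: vec_eq_iff transpose_def in_basis_diag_component mult_ac)

lemma exp_const_integrable: "(\<lambda>t. exp (c * t)) integrable_on {0..T::real}"
  by (intro integrable_continuous_real continuous_intros)

text \<open>A constant lower bound on the integrand works for every sign of \<open>c\<close> and
  avoids the case split at \<open>c = 0\<close> of the closed form.\<close>

lemma integral_exp_pos:
  fixes T :: real
  assumes "T > 0"
  shows "0 < integral {0..T} (\<lambda>t. exp (c * t))"
proof -
  have "0 < T * exp (- (\<bar>c\<bar> * T))" using assms by simp
  also have "\<dots> = integral {0..T} (\<lambda>t. exp (- (\<bar>c\<bar> * T)))" using assms by simp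
  also have "\<dots> \<le> integral {0..T} (\<lambda>t. exp (c * t))"
  proof (rule integral_le)
    show "exp (- (\<bar>c\<bar> * T)) \<le> exp (c * t)" if "t \<in> {0..T}" for t
    proof -
      have "\<bar>c * t\<bar> \<le> \<bar>c\<bar> * T" using that by (simp add: abs_mult mult_left_mono)
      then show ?thesis by simp
    qed
  qed (auto intro: exp_const_integrable integrable_continuous_real)
  finally show ?thesis .
qed

lemma gfun_pos: "T > 0 \<Longrightarrow> 0 < gfun c T"
  unfolding gfun_def by (rule integral_exp_pos)

locale eigenbasis =
  fixes A :: "real^'n^'n" and e :: "'n \<Rightarrow> real^'n" and a :: "'n \<Rightarrow> real"
  assumes basis: "orthonormal_eigenbasis A e a"
begin

lemma orthonormal: "e i \<bullet> e j = (if i = j then 1 else 0)"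
  and eigenvector: "A *v e j = a j *\<^sub>R e j"
  using basis by (auto simp: orthonormal_eigenbasis_def)

lemma in_basis_diag_e: "in_basis e (diag d) *v e j = d j *\<^sub>R e j"
proof -
  have "in_basis e (diag d) *v e j = (\<Sum>i\<in>UNIV. if i = j then d j *\<^sub>R e j else 0)"
    unfolding in_basis_diag_mult by (intro sum.cong) (auto simp: orthonormal)
  then show ?thesis by simp
qed

lemma basis_matrix:
  defines "Q \<equiv> \<chi> i j. e j $ i"
  shows "transpose Q ** Q = mat 1" "Q ** transpose Q = mat 1"
proof -
  have "(transpose Q ** Q) $ i $ j = e i \<bullet> e j" for i j
    by (simp add: Q_def matrix_matrix_mult_def transpose_def inner_vec_def)
  then show "transpose Q ** Q = mat 1"
    by (simp add: vec_eq_iff orthonormal mat_def)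
  then show "Q ** transpose Q = mat 1"
    using matrix_left_right_inverse by blast
qed

text \<open>Completeness of the basis is the identity \<open>Q ** transpose Q = mat 1\<close>, read
  as the spectral form with all weights 1.\<close>

lemma expansion: "v = (\<Sum>j\<in>UNIV. (e j \<bullet> v) *\<^sub>R e j)"
proof -
  have "diag (\<lambda>_. 1) = (mat 1 :: real^'n^'n)" by (simp add: diag_def mat_def)
  then have "in_basis e (diag (\<lambda>_. 1)) = mat 1"
    by (simp add: in_basis_def Let_def basis_matrix)
  then show ?thesis using in_basis_diag_mult[of e "\<lambda>_. 1" v] by simp
qed

lemma vector_eqI: "(\<And>i. e i \<bullet> u = e i \<bullet> v) \<Longrightarrow> u = v"
  using expansion[of u] expansion[of v] by simp

lemma matrix_eqI_basis:
  assumes "\<And>j. M *v e j = N *v e j"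
  shows "M = (N :: real^'n^'n)"
proof -
  have "M *v v = N *v v" for v
  proof -
    have "M *v v = (\<Sum>j\<in>UNIV. (e j \<bullet> v) *\<^sub>R (M *v e j))" for M :: "real^'n^'n"
      by (subst expansion[of v])
        (simp add: linear_sum[OF matrix_vector_mul_linear] matrix_vector_mult_scaleR)
    then show ?thesis using assms by simp
  qed
  then show ?thesis by (simp add: matrix_eq)
qed

lemma matrix_eqI: "(\<And>i j. e i \<bullet> (M *v e j) = e i \<bullet> (N *v e j)) \<Longrightarrow> M = N"
  by (intro matrix_eqI_basis vector_eqI)

text \<open>Insert \<open>Q ** transpose Q\<close> and use cyclicity of the trace.\<close>

lemma trace_eq: "trace X = (\<Sum>j\<in>UNIV. e j \<bullet> (X *v e j))"
proof -
  define Q where "Q = (\<chi> i j. e j $ i)"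
  have "trace X = trace (Q ** (transpose Q ** X))"
    by (simp add: matrix_mul_assoc Q_def basis_matrix)
  also have "\<dots> = trace (transpose Q ** (X ** Q))"
    by (subst trace_mul_sym) (simp add: matrix_mul_assoc)
  also have "\<dots> = (\<Sum>j\<in>UNIV. e j \<bullet> (X *v e j))"
    by (simp add: trace_def Q_def matrix_matrix_mult_def transpose_def inner_vec_def
        matrix_vector_mult_def)
  finally show ?thesis .
qed

lemma matpow_eq: "matpow (t *\<^sub>R A) k = in_basis e (diag (\<lambda>j. (t * a j) ^ k))"
proof (rule matrix_eqI_basis)
  show "matpow (t *\<^sub>R A) k *v e j = in_basis e (diag (\<lambda>j. (t * a j) ^ k)) *v e j" for j
  proof (induction k)
    case (Suc k)
    have "matpow (t *\<^sub>R A) (Suc k) *v e j = (t *\<^sub>R A) *v (matpow (t *\<^sub>R A) k *v e j)"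
      by (simp add: matpow_def matrix_vector_mul_assoc)
    with Suc show ?case
      by (simp add: in_basis_diag_e matrix_vector_mult_scaleR eigenvector
          flip: scaleR_matrix_vector_assoc)
  qed (simp add: matpow_def in_basis_diag_e)
qed

text \<open>Each entry of the matrix series is a finite combination of scalar exponential series.
  Arguing with \<open>sums\<close> gives convergence together with the value of the infinite
  sum.\<close>

lemma mexp_eq: "mexp (t *\<^sub>R A) = in_basis e (diag (\<lambda>j. exp (t * a j)))"
proof -
  have "(\<lambda>k. ((1 / fact k) *\<^sub>R matpow (t *\<^sub>R A) k) $ r $ s) sums
      in_basis e (diag (\<lambda>j. exp (t * a j))) $ r $ s" for r s
  proof -
    have "(\<lambda>k. \<Sum>j\<in>UNIV. e j $ r * ((t * a j) ^ k /\<^sub>R fact k) * e j $ s) sums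
        (\<Sum>j\<in>UNIV. e j $ r * exp (t * a j) * e j $ s)"
      by (intro sums_sum sums_mult sums_mult2 exp_converges)
    then show ?thesis
      by (simp add: matpow_eq in_basis_diag_component sum_distrib_left divide_inverse mult_ac)
  qed
  then have "(\<lambda>k. (1 / fact k) *\<^sub>R matpow (t *\<^sub>R A) k) sums in_basis e (diag (\<lambda>j. exp (t * a j)))"
    unfolding sums_def by (intro vec_tendstoI) simp
  then show ?thesis unfolding mexp_def by (rule sums_unique[symmetric])
qed

text \<open>In the eigenbasis the Gramian multiplies each entry by a positive scalar when
  \<open>T > 0\<close>. Taking an entry is a bounded linear functional, so it passes through the
  integral, and the symmetric exponentials act on \<open>e i\<close> and \<open>e j\<close> as
  scalars.\<close>

lemma gramian_entry:
  assumes sym: "transpose A = A"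
  shows "e i \<bullet> (gramian A T X *v e j) =
    integral {0..T} (\<lambda>t. exp ((a i + a j) * t)) * (e i \<bullet> (X *v e j))"
proof -
  define E where "E t = in_basis e (diag (\<lambda>j. exp (t * a j)))" for t
  have "continuous_on {0..T} (\<lambda>t. E t ** X ** E t)"
    unfolding E_def matrix_matrix_mult_def in_basis_diag_component
    by (intro continuous_intros)
  then have int: "(\<lambda>t. E t ** X ** E t) integrable_on {0..T}"
    by (rule integrable_continuous_real)
  have lin: "bounded_linear (\<lambda>M :: real^'n^'n. e i \<bullet> (M *v e j))"
    unfolding linear_conv_bounded_linear[symmetric]
    by (rule linearI)
      (simp_all add: matrix_vector_mult_add_rdistrib inner_add_right flip: scaleR_matrix_vector_assoc)
  have entry: "e i \<bullet> ((E t ** X ** E t) *v e j) = exp ((a i + a j) * t) * (e i \<bullet> (X *v e j))" for t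
  proof -
    have "e i \<bullet> ((E t ** X ** E t) *v e j) = e i \<bullet> (E t *v (X *v (E t *v e j)))"
      by (simp add: matrix_vector_mul_assoc matrix_mul_assoc)
    also have "\<dots> = (E t *v e i) \<bullet> (X *v (E t *v e j))"
      using symmetric_dot[of "E t"] by (simp add: E_def transpose_in_basis_diag)
    also have "\<dots> = exp (t * a i) * exp (t * a j) * (e i \<bullet> (X *v e j))"
      by (simp add: E_def in_basis_diag_e matrix_vector_mult_scaleR)
    finally show ?thesis by (simp add: mult_exp_exp algebra_simps)
  qed
  \<comment> \<open>Symmetry of \<open>A\<close> makes the two exponential factors equal.\<close>
  have "gramian A T X = integral {0..T} (\<lambda>t. E t ** X ** E t)"
    by (simp add: gramian_def sym mexp_eq E_def)
  then have "e i \<bullet> (gramian A T X *v e j) = integral {0..T} (\<lambda>t. e i \<bullet> ((E t ** X ** E t) *v e j))"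
    using integral_linear[OF int lin] by (simp add: o_def)
  then show ?thesis by (simp add: entry)
qed

end

subsection \<open>Maximizing the least eigenvalue\<close>

text \<open>Replacing \<open>M\<close> by \<open>N\<close> changes the form at \<open>u\<close> by
  at most \<open>C * dist M N\<close> times \<open>u \<bullet> u\<close>; hence
  \<open>lambda_min\<close> is Lipschitz on symmetric matrices.\<close>

lemma continuous_on_lambda_min: "continuous_on {M :: real^'n^'n. transpose M = M} lambda_min"
proof -
  obtain C where C: "C > 0" "\<And>M x. norm ((M :: real^'n^'n) *v x) \<le> C * norm M * norm x"
    using matrix_vector_mult_bound by blast
  have le: "lambda_min M - C * dist M N \<le> lambda_min N"
    if "transpose M = M" "transpose N = N" for M N :: "real^'n^'n"
  proof (rule le_lambda_min[OF that(2)])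
    fix u :: "real^'n"
    have "lambda_min M * (u \<bullet> u) \<le> u \<bullet> (M *v u)" by (rule lambda_min_le[OF that(1)])
    also have "\<dots> = u \<bullet> (N *v u) + u \<bullet> ((M - N) *v u)"
      by (simp add: matrix_vector_mult_diff_rdistrib inner_diff_right)
    also have "u \<bullet> ((M - N) *v u) \<le> norm u * (C * dist M N * norm u)"
      unfolding dist_norm
      using norm_cauchy_schwarz C(2)[of "M - N" u] by (meson mult_left_mono norm_ge_zero order_trans)
    also have "\<dots> = C * dist M N * (u \<bullet> u)"
      by (simp add: dot_square_norm power2_eq_square)
    finally show "(lambda_min M - C * dist M N) * (u \<bullet> u) \<le> u \<bullet> (N *v u)"
      by (simp add: algebra_simps)
  qed
  have "C-lipschitz_on {M :: real^'n^'n. transpose M = M} lambda_min"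
  proof (rule lipschitz_onI)
    fix M N :: "real^'n^'n"
    assume "M \<in> {M. transpose M = M}" "N \<in> {M. transpose M = M}"
    then show "dist (lambda_min M) (lambda_min N) \<le> C * dist M N"
      using le[of M N] le[of N M] by (simp add: dist_real_def dist_commute abs_le_iff)
  qed (use C in simp)
  then show ?thesis by (rule lipschitz_on_continuous_on)
qed

lemma psd_entry_le_trace:
  fixes X :: "real^'n^'n"
  assumes X: "psd X"
  shows "\<bar>X $ i $ j\<bar> \<le> trace X"
proof -
  have sym: "X $ j $ i = X $ i $ j"
    using X by (simp add: psd_def transpose_def vec_eq_iff)
  have entry: "axis r 1 \<bullet> (X *v axis s 1) = X $ r $ s" for r s
    by (simp add: inner_axis' matrix_vector_mult_basis column_def)
  have diag: "0 \<le> X $ r $ r" for r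
    using X entry[of r r] unfolding psd_def by metis
  have le: "X $ r $ r \<le> trace X" for r
    unfolding trace_def using diag by (intro member_le_sum) auto
  \<comment> \<open>The choices 1 and -1 for \<open>c\<close> bound twice the absolute value of the
    entry by the sum of two diagonal entries, each at most the trace.\<close>
  have "0 \<le> (axis i 1 + c *\<^sub>R axis j 1) \<bullet> (X *v (axis i 1 + c *\<^sub>R axis j 1))" for c
    using X by (simp add: psd_def)
  then have quad: "0 \<le> X $ i $ i + 2 * c * X $ i $ j + c * c * X $ j $ j" for c
    by (simp add: matrix_vector_right_distrib matrix_vector_mult_scaleR inner_add_left
        inner_add_right entry sym algebra_simps)
  show ?thesis
    using quad[of 1] quad[of "-1"] le[of i] le[of j] by simp
qed

lemma compact_psd_trace_one: "compact {X :: real^'n^'n. psd X \<and> trace X = 1}"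
proof -
  have "norm X \<le> CARD('n) * CARD('n)" if X: "psd X" "trace X = 1" for X :: "real^'n^'n"
  proof -
    have "norm (X $ i) \<le> CARD('n)" for i
    proof -
      have "norm (X $ i) \<le> (\<Sum>j\<in>UNIV. \<bar>X $ i $ j\<bar>)" by (rule norm_le_l1_cart)
      also have "\<dots> \<le> (\<Sum>j\<in>(UNIV :: 'n set). 1)"
        using psd_entry_le_trace[OF X(1)] X(2) by (intro sum_mono) simp
      finally show ?thesis by simp
    qed
    then have "(\<Sum>i\<in>UNIV. norm (X $ i)) \<le> (\<Sum>i\<in>(UNIV :: 'n set). real CARD('n))"
      by (intro sum_mono)
    then show ?thesis
      using L2_set_le_sum[of UNIV "\<lambda>i. norm (X $ i)"] by (simp add: norm_vec_def)
  qed
  then have "bounded {X :: real^'n^'n. psd X \<and> trace X = 1}"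
    unfolding bounded_iff by blast
  \<comment> \<open>Unfolded, all conditions are equalities and weak inequalities between continuous
    functions of the entries.\<close>
  moreover have "closed {X :: real^'n^'n. psd X \<and> trace X = 1}"
    unfolding psd_def transpose_def trace_def matrix_vector_mult_def inner_vec_def
    by (intro closed_Collect_conj closed_Collect_all closed_Collect_eq closed_Collect_le
        continuous_intros)
  ultimately show ?thesis by (simp add: compact_eq_bounded_closed)
qed

text \<open>Ensures that the maximum in \<open>gamma_k\<close> ranges over a nonempty set as soon as
  \<open>k\<close> is at least 1.\<close>

lemma rank_one_psd:
  obtains X :: "real^'n^'n" where "psd X" "trace X = 1" "rank X \<le> 1"
proof -
  define i :: 'n where "i = undefined"
  define X :: "real^'n^'n" where "X = diag (\<lambda>j. if j = i then 1 else 0)"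
  have X: "X *v v = v $ i *\<^sub>R axis i 1" for v
    by (simp add: X_def diag_def matrix_vector_mult_def vec_eq_iff axis_def
        if_distrib[of "\<lambda>x. x * _"] cong: if_cong)
  have "transpose X = X" by (auto simp: X_def diag_def transpose_def vec_eq_iff)
  moreover have "v \<bullet> (X *v v) = v $ i * v $ i" for v by (simp add: X inner_axis)
  ultimately have "psd X" by (simp add: psd_def)
  moreover have "trace X = 1" by (simp add: X_def diag_def trace_def)
  moreover have "rank X \<le> 1"
  proof -
    have "range ((*v) X) \<subseteq> span {axis i 1}" by (auto simp: X span_scale span_base)
    then have "rank X \<le> card {axis i (1::real)}"
      unfolding rank_dim_range by (rule dim_le_card) simp
    then show ?thesis by simp
  qed
  ultimately show ?thesis by (rule that)
qed

section \<open>Value and uniqueness of the optimum\<close>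

locale gramian_eigenbasis = eigenbasis A e a
  for A :: "real^'n^'n" and e a +
  fixes T :: real
  assumes sym: "transpose A = A" and T_pos: "T > 0"
begin

definition \<gamma> :: real where "\<gamma> = inverse (\<Sum>j\<in>UNIV. 1 / gfun (a j) T)"

text \<open>The weights equalize the Gramian: \<open>gfun (a j) T\<close> times the
  \<open>j\<close>-th weight is \<gamma> for all \<open>j\<close>.\<close>

definition Xstar :: "real^'n^'n" where "Xstar = in_basis e (diag (\<lambda>j. \<gamma> / gfun (a j) T))"

lemma sum_inverse_gfun_pos: "0 < (\<Sum>j\<in>UNIV. 1 / gfun (a j) T)"
  by (intro sum_pos) (simp_all add: gfun_pos T_pos)

lemma gamma_pos: "0 < \<gamma>"
  unfolding \<gamma>_def using sum_inverse_gfun_pos by simp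

lemma gramian_diag: "e j \<bullet> (gramian A T X *v e j) = gfun (a j) T * (e j \<bullet> (X *v e j))"
  by (simp add: gramian_entry[OF sym] gfun_def)

text \<open>The scalar multiplying entry \<open>i\<close>, \<open>j\<close> depends only on
  \<open>a i + a j\<close>, so it is symmetric in the indices.\<close>

lemma gramian_symmetric:
  assumes "transpose X = X"
  shows "transpose (gramian A T X) = gramian A T X"
proof (rule matrix_eqI)
  fix i j
  have "e i \<bullet> (transpose (gramian A T X) *v e j) = e j \<bullet> (gramian A T X *v e i)"
    by (simp add: inner_commute[of "e i"] dot_lmul_matrix)
  also have "\<dots> = e i \<bullet> (gramian A T X *v e j)"
    using symmetric_dot[OF assms, of "e i" "e j"]
    by (simp add: gramian_entry[OF sym] add.commute inner_commute)
  finally show "e i \<bullet> (transpose (gramian A T X) *v e j) = e i \<bullet> (gramian A T X *v e j)" .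
qed

lemma linear_gramian: "linear (gramian A T)"
  by (rule linearI; rule matrix_eqI)
    (simp_all add: gramian_entry[OF sym] matrix_vector_mult_add_rdistrib inner_add_right
      distrib_left flip: scaleR_matrix_vector_assoc)

text \<open>Test the Gramian with \<open>e j\<close>. After division by \<open>gfun (a j) T\<close>,
  summation over \<open>j\<close> turns the right side into the trace.\<close>

lemma lambda_min_weighted_le:
  assumes "psd X"
  shows "lambda_min (gramian A T X) / gfun (a j) T \<le> e j \<bullet> (X *v e j)"
proof -
  have "lambda_min (gramian A T X) * (e j \<bullet> e j) \<le> e j \<bullet> (gramian A T X *v e j)"
    using assms by (intro lambda_min_le gramian_symmetric) (simp add: psd_def)
  then show ?thesis
    using gfun_pos[OF T_pos, of "a j"] by (simp add: orthonormal gramian_diag field_simps)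
qed

lemma lambda_min_le_gamma:
  assumes "psd X" "trace X = 1"
  shows "lambda_min (gramian A T X) \<le> \<gamma>"
proof -
  have "lambda_min (gramian A T X) * (\<Sum>j\<in>UNIV. 1 / gfun (a j) T)
      = (\<Sum>j\<in>UNIV. lambda_min (gramian A T X) / gfun (a j) T)"
    by (simp add: sum_distrib_left)
  also have "\<dots> \<le> (\<Sum>j\<in>UNIV. e j \<bullet> (X *v e j))"
    by (intro sum_mono lambda_min_weighted_le assms)
  also have "\<dots> = 1" using assms by (simp flip: trace_eq)
  finally show ?thesis using sum_inverse_gfun_pos by (simp add: \<gamma>_def field_simps)
qed

lemma sum_gamma: "(\<Sum>j\<in>UNIV. \<gamma> / gfun (a j) T) = 1"
proof -
  have "(\<Sum>j\<in>UNIV. \<gamma> / gfun (a j) T) = \<gamma> * (\<Sum>j\<in>UNIV. 1 / gfun (a j) T)"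
    by (simp add: sum_distrib_left)
  then show ?thesis using sum_inverse_gfun_pos by (simp add: \<gamma>_def)
qed

lemma eq_Xstar:
  assumes X: "psd X" "trace X = 1" and max: "lambda_min (gramian A T X) = \<gamma>"
  shows "X = Xstar"
proof (rule matrix_eqI)
  fix i j
  have symX: "transpose X = X" using X by (simp add: psd_def)
  \<comment> \<open>Both sides of the weighted inequalities sum to 1, so none of them can be
    strict.\<close>
  have diag: "\<gamma> / gfun (a j) T = e j \<bullet> (X *v e j)" for j
    using sum_mono_inv[of "\<lambda>j. \<gamma> / gfun (a j) T" UNIV "\<lambda>j. e j \<bullet> (X *v e j)" j]
      lambda_min_weighted_le[OF X(1)] X(2) by (simp add: max sum_gamma flip: trace_eq)
  define N where "N = gramian A T X - mat \<gamma>"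
  have N: "N *v u = gramian A T X *v u - \<gamma> *\<^sub>R u" for u
    by (simp add: N_def matrix_vector_mult_diff_rdistrib mat_vector_mult)
  have "N *v e j = 0"
  proof (rule quadratic_form_null[OF _ subspace_UNIV])
    show "transpose N = N"
      using gramian_symmetric[OF symX] by (simp add: N_def transpose_def vec_eq_iff mat_def)
    show "0 \<le> u \<bullet> (N *v u)" for u
      using lambda_min_le[OF gramian_symmetric[OF symX], of u] by (simp add: max N inner_diff_right)
    show "e j \<bullet> (N *v e j) = 0"
      using gfun_pos[OF T_pos, of "a j"]
      by (simp add: N inner_diff_right orthonormal gramian_diag flip: diag)
  qed simp_all
  then have "e i \<bullet> (gramian A T X *v e j) = \<gamma> * (e i \<bullet> e j)" by (simp add: N)
  \<comment> \<open>The off-diagonal Gramian entry vanishes, and its integral factor is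
    positive.\<close>
  then have off: "i \<noteq> j \<Longrightarrow> e i \<bullet> (X *v e j) = 0"
    using integral_exp_pos[OF T_pos, of "a i + a j"] by (simp add: gramian_entry[OF sym] orthonormal)
  show "e i \<bullet> (X *v e j) = e i \<bullet> (Xstar *v e j)"
    using off diag[of j] by (cases "i = j") (simp_all add: Xstar_def in_basis_diag_e orthonormal)
qed

lemma Xstar_quadratic: "v \<bullet> (Xstar *v v) = (\<Sum>j\<in>UNIV. \<gamma> / gfun (a j) T * (e j \<bullet> v)\<^sup>2)"
  by (simp add: Xstar_def in_basis_diag_mult inner_sum_right power2_eq_square inner_commute mult_ac)

lemma weight_pos: "0 < \<gamma> / gfun (a j) T"
  using gamma_pos gfun_pos[OF T_pos] by simp

lemma psd_Xstar: "psd Xstar"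
  unfolding psd_def Xstar_quadratic
proof (intro conjI allI sum_nonneg mult_nonneg_nonneg zero_le_power2)
  show "transpose Xstar = Xstar" by (simp only: Xstar_def transpose_in_basis_diag)
  show "0 \<le> \<gamma> / gfun (a j) T" for j by (rule less_imp_le[OF weight_pos])
qed

lemma trace_Xstar: "trace Xstar = 1"
  by (simp add: trace_eq Xstar_def in_basis_diag_e orthonormal sum_gamma)

lemma gramian_Xstar: "gramian A T Xstar = mat \<gamma>"
proof (rule matrix_eqI)
  fix i j
  show "e i \<bullet> (gramian A T Xstar *v e j) = e i \<bullet> (mat \<gamma> *v e j)"
    using gfun_pos[OF T_pos, of "a j"]
    by (cases "i = j")
      (simp add: gramian_diag Xstar_def in_basis_diag_e mat_vector_mult orthonormal,
       simp add: gramian_entry[OF sym] Xstar_def in_basis_diag_e mat_vector_mult orthonormal)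
qed

lemma lambda_min_Xstar: "lambda_min (gramian A T Xstar) = \<gamma>"
proof (rule antisym)
  show "lambda_min (gramian A T Xstar) \<le> \<gamma>"
    by (rule lambda_min_le_gamma[OF psd_Xstar trace_Xstar])
  show "\<gamma> \<le> lambda_min (gramian A T Xstar)"
    using psd_Xstar
    by (intro le_lambda_min gramian_symmetric) (simp_all add: psd_def gramian_Xstar mat_vector_mult)
qed

text \<open>All weights in the quadratic form are positive, so the kernel is trivial.\<close>

lemma rank_Xstar: "rank Xstar = CARD('n)"
proof -
  have "v = 0" if "Xstar *v v = 0" for v
  proof (rule vector_eqI)
    fix i
    have "(\<Sum>j\<in>UNIV. \<gamma> / gfun (a j) T * (e j \<bullet> v)\<^sup>2) = 0"
      using that Xstar_quadratic[of v] by simp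
    then have "\<gamma> / gfun (a i) T * (e i \<bullet> v)\<^sup>2 = 0"
      by (subst (asm) sum_nonneg_eq_0_iff)
        (auto intro: mult_nonneg_nonneg simp del: times_divide_eq_left simp: less_imp_le[OF weight_pos])
    then show "e i \<bullet> v = e i \<bullet> 0" using weight_pos[of i] by auto
  qed
  then show ?thesis using matrix_nonfull_linear_equations_eq by blast
qed

lemma gamma_rel_eq: "gamma_rel A T = \<gamma>"
  unfolding gamma_rel_def
  using psd_Xstar trace_Xstar lambda_min_Xstar lambda_min_le_gamma
  by (intro Greatest_equality) auto

text \<open>A maximizer is not beaten by \<open>Xstar\<close>, so the upper bound forces its value
  to be \<gamma>, and \<open>eq_Xstar\<close> applies.\<close>

lemma relaxed_maximizer_iff: "relaxed_maximizer A T X \<longleftrightarrow> X = Xstar"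
  unfolding relaxed_maximizer_def is_arg_max_def
  using psd_Xstar trace_Xstar lambda_min_Xstar lambda_min_le_gamma eq_Xstar
  by (metis less_le not_less)

lemma least_rank_eq: "least_rank A T = CARD('n)"
  unfolding least_rank_def by (rule Least_equality) (auto simp: relaxed_maximizer_iff rank_Xstar)

text \<open>The maximum is attained by some \<open>X\<close> of rank at most \<open>k\<close>; the
  value \<gamma> would force \<open>X = Xstar\<close>, which has full rank.\<close>

lemma gamma_k_less:
  assumes k: "1 \<le> k" "k < CARD('n)"
  shows "gamma_k k A T < \<gamma>"
proof -
  let ?f = "\<lambda>X. lambda_min (gramian A T X)"
  let ?K = "{X :: real^'n^'n. psd X \<and> trace X = 1} \<inter> {X. rank X \<le> k}"
  have "compact ?K" by (intro compact_Int_closed compact_psd_trace_one closed_rank_le)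
  moreover have "?K \<noteq> {}"
  proof -
    obtain X :: "real^'n^'n" where "psd X" "trace X = 1" "rank X \<le> 1"
      by (rule rank_one_psd)
    then have "X \<in> ?K" using k by simp
    then show ?thesis by blast
  qed
  \<comment> \<open>The Gramian map is linear, hence continuous in finite dimension, and maps
    symmetric matrices to symmetric ones, where \<open>lambda_min\<close> is continuous.\<close>
  moreover have "continuous_on ?K ?f"
    using linear_gramian
    by (intro continuous_on_compose2[OF continuous_on_lambda_min] linear_continuous_on)
      (auto simp: linear_conv_bounded_linear gramian_symmetric psd_def)
  ultimately obtain X where X: "X \<in> ?K" and max: "\<And>Y. Y \<in> ?K \<Longrightarrow> ?f Y \<le> ?f X"
    using continuous_attains_sup[of ?K ?f] by blast
  have "gamma_k k A T = ?f X"
    unfolding gamma_k_def using X max by (intro Greatest_equality) auto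
  moreover have "?f X \<noteq> \<gamma>" using eq_Xstar[of X] X k rank_Xstar by auto
  ultimately show ?thesis using lambda_min_le_gamma[of X] X by simp
qed

end

theorem proposition2p9:
  fixes A :: "real^'n^'n" and T :: real
  assumes "CARD('n) \<ge> 2" and "A = transpose A" and "T > 0"
  shows "(\<forall>e a. orthonormal_eigenbasis A e a \<longrightarrow>
            gamma_rel A T = inverse (\<Sum>j\<in>UNIV. 1 / gfun (a j) T) \<and>
            (\<forall>X. relaxed_maximizer A T X \<longleftrightarrow>
                 X = in_basis e (diag (\<lambda>j. gamma_rel A T / gfun (a j) T)))) \<and>
         least_rank A T = CARD('n) \<and>
         (\<forall>k. 1 \<le> k \<and> k < CARD('n) \<longrightarrow> gamma_k k A T < gamma_rel A T)"
proof -
  have loc: "gramian_eigenbasis A e a T" if "orthonormal_eigenbasis A e a" for e a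
    using that assms by unfold_locales simp_all
  \<comment> \<open>This basis serves the claims free of a basis; the locale is interpreted again
    below for the arbitrary one.\<close>
  obtain e a where ea: "orthonormal_eigenbasis A e a"
    using symmetric_orthonormal_eigenbasis[of A] assms(2) by metis
  interpret gramian_eigenbasis A e a T by (rule loc[OF ea])
  show ?thesis
  proof (intro conjI allI impI)
    fix e' a'
    assume "orthonormal_eigenbasis A e' a'"
    then interpret B: gramian_eigenbasis A e' a' T by (rule loc)
    show "gamma_rel A T = inverse (\<Sum>j\<in>UNIV. 1 / gfun (a' j) T)"
      using B.gamma_rel_eq by (simp only: B.\<gamma>_def)
    show "relaxed_maximizer A T X \<longleftrightarrow>
        X = in_basis e' (diag (\<lambda>j. gamma_rel A T / gfun (a' j) T))" for X
      unfolding B.gamma_rel_eq B.Xstar_def[symmetric] by (rule B.relaxed_maximizer_iff)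
  next
    show "least_rank A T = CARD('n)" by (rule least_rank_eq)
  next
    fix k
    assume "1 \<le> k \<and> k < CARD('n)"
    then show "gamma_k k A T < gamma_rel A T" by (simp add: gamma_k_less gamma_rel_eq)
  qed
qed

end
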